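(* Let $G$ be a graph with vertex set $V(G)$ and adjacency matrix $A$. Let $B$ be a (real) symmetric matrix such that, for some time $t\in\mathbb{R}$ and some $\lambda\in\mathbb{C}$, \[ \exp(\mathrm{i} t B)\, e_i = \lambda\, e_j , \] where $e_i,e_j$ are standard basis vectors indexed by rows/columns of $B$. Let $P$ be the characteristic matrix of a partition of $V(G)$ (rows indexed by $V(G)$, columns by the cells of the partition, in the same index set as $B$), let $u,v\in V(G)$, and let $D$ be a diagonal matrix indexed by $V(G)$, such that $P e_i = e_u$, $P e_j = e_v$, and $D_{uu}=D_{vv}=1$. Assume the column space of $DP$ is $A$-invariant, let $S$ be the matrix obtained from $DP$ by normalizing each of its columns, and assume that $AS = SB$. Then $G$ admits perfect state transfer between $u$ and $v$.
   Context: For a vertex $w$, $e_w$ denotes its characteristic vector. The transition matrix of the continuous-time quantum walk on $G$ is $U(t)=\exp(\mathrm{i} t A)$. Perfect state transfer occurs in $G$ between vertices $u$ and $v$ if there exist a time $t$ and a complex number $\gamma$ with $|\gamma|=1$ such that $U(t)e_u=\gamma e_v$. The characteristic matrix of a partition of $V(G)$ is the $0/1$ matrix whose columns are the characteristic vectors of the cells. Normalizing a column means dividing it by its Euclidean norm. *)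

theory Defs
  imports "HOL-Analysis.Analysis" "Graph_Theory.Digraph"
begin

primrec matrix_power :: "'a::semiring_1^'n^'n \<Rightarrow> nat \<Rightarrow> 'a^'n^'n" where
  "matrix_power M 0 = mat 1"
| "matrix_power M (Suc k) = M ** matrix_power M k"

text \<open>The type \<open>complex^'n^'n\<close> is not an instance of the class of normed algebras, so the
  library function \<open>exp\<close> does not apply to it. The series below always converges
  (lemma \<open>summable_matrix_exp\<close>).\<close>

definition matrix_exp :: "complex^'n^'n \<Rightarrow> complex^'n^'n" where
  "matrix_exp M = (\<Sum>k. (1 / fact k) *\<^sub>R matrix_power M k)"

lemma matrix_power_entry_bound:
  fixes M :: "complex^'n^'n"
  assumes "\<And>i j. norm (M $ i $ j) \<le> c"
  shows "norm (matrix_power M k $ i $ j) \<le> (real CARD('n) * c) ^ k"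
proof (induction k arbitrary: i j)
  case 0
  show ?case by (simp add: mat_def)
next
  case (Suc k)
  have "norm (matrix_power M (Suc k) $ i $ j)
      \<le> (\<Sum>l\<in>UNIV. norm (M $ i $ l * matrix_power M k $ l $ j))"
    by (simp add: matrix_matrix_mult_def norm_sum)
  also have "\<dots> \<le> (\<Sum>l\<in>(UNIV::'n set). c * (real CARD('n) * c) ^ k)"
    using order_trans[OF norm_ge_zero assms]
    by (intro sum_mono) (auto simp: norm_mult intro!: mult_mono assms Suc)
  finally show ?case by simp
qed

lemma summable_matrix_exp:
  fixes M :: "complex^'n^'n"
  shows "summable (\<lambda>k. (1 / fact k) *\<^sub>R matrix_power M k)"
proof -
  define c where "c = (\<Sum>i\<in>UNIV. \<Sum>j\<in>UNIV. norm (M $ i $ j))"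
  have c: "norm (M $ i $ j) \<le> c" for i j
  proof -
    have "norm (M $ i $ j) \<le> (\<Sum>j\<in>UNIV. norm (M $ i $ j))"
      by (rule member_le_sum) auto
    also have "\<dots> \<le> c"
      unfolding c_def
      by (rule member_le_sum[of i UNIV "\<lambda>i. \<Sum>j\<in>UNIV. norm (M $ i $ j)"]) (auto intro: sum_nonneg)
    finally show ?thesis .
  qed
  have entry: "summable (\<lambda>k. ((1 / fact k) *\<^sub>R matrix_power M k) $ i $ j)" for i j
  proof (rule summable_comparison_test')
    show "summable (\<lambda>k. inverse (fact k) * (real CARD('n) * c) ^ k)"
      by (rule summable_exp)
    show "norm (((1 / fact k) *\<^sub>R matrix_power M k) $ i $ j)
        \<le> inverse (fact k) * (real CARD('n) * c) ^ k" if "k \<ge> 0" for k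
      using matrix_power_entry_bound[OF c, of k i j]
      by (simp add: divide_inverse mult_left_mono)
  qed
  have "(\<lambda>k. (1 / fact k) *\<^sub>R matrix_power M k) sums
      (\<chi> i j. \<Sum>k. ((1 / fact k) *\<^sub>R matrix_power M k) $ i $ j)"
    unfolding sums_def
    by (intro vec_tendstoI)
       (use summable_LIMSEQ[OF entry] in \<open>simp only: sum_component vec_lambda_beta\<close>)
  then show ?thesis by (rule sums_summable)
qed

definition quantum_walk :: "complex^'n^'n \<Rightarrow> real \<Rightarrow> complex^'n^'n" where
  "quantum_walk M t = matrix_exp (map_matrix (\<lambda>x. \<i> * complex_of_real t * x) M)"

definition adjacency_matrix :: "('v::finite, 'e) pre_digraph \<Rightarrow> 'a::zero_neq_one^'v^'v" where
  "adjacency_matrix G = (\<chi> x y. if x \<rightarrow>\<^bsub>G\<^esub> y then 1 else 0)"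

definition perfect_state_transfer :: "('v::finite, 'e) pre_digraph \<Rightarrow> 'v \<Rightarrow> 'v \<Rightarrow> bool" where
  "perfect_state_transfer G u v \<longleftrightarrow>
    (\<exists>t \<gamma>. norm \<gamma> = 1 \<and> quantum_walk (adjacency_matrix G) t *v axis u 1 = \<gamma> *s axis v 1)"

definition characteristic_matrix :: "('m \<Rightarrow> 'v set) \<Rightarrow> 'a::zero_neq_one^'m^'v" where
  "characteristic_matrix C = (\<chi> x k. if x \<in> C k then 1 else 0)"

text \<open>The norm on \<open>complex^'v\<close> is the Euclidean norm. A zero column, which cannot be normalized,
  stays zero because \<open>x / 0 = 0\<close>.\<close>

definition normalize_columns :: "complex^'m^'v \<Rightarrow> complex^'m^'v" where
  "normalize_columns M = (\<chi> x k. M $ x $ k / complex_of_real (norm (column k M)))"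

text \<open>The span over the entry field is \<open>vec.span\<close>; plain \<open>span\<close> is the real span.\<close>

definition column_space :: "'a::field^'m^'v \<Rightarrow> ('a^'v) set" where
  "column_space M = vec.span (columns M)"

end

theory Submission
  imports Defs
begin

text \<open>Since \<open>DPe\<^sub>i = De\<^sub>u = e\<^sub>u\<close> already has norm one, normalizing does not change it, so
  \<open>Se\<^sub>i = e\<^sub>u\<close> and likewise \<open>Se\<^sub>j = e\<^sub>v\<close>. The relation \<open>AS = SB\<close> passes to powers and hence to
  exponentials, which gives \<open>exp(itA)e\<^sub>u = S exp(itB)e\<^sub>i = \<lambda>e\<^sub>v\<close>. Finally \<open>|\<lambda>| = 1\<close> because
  \<open>exp(itB)\<close> is unitary for a real symmetric \<open>B\<close>.\<close>

section \<open>Real-linear maps on matrices, and matrix powers\<close>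

lemma linear_matrix_mult_left: "linear (\<lambda>M::complex^'n^'m. M ** N)"
  by (rule linearI)
     (simp_all add: vec_eq_iff matrix_matrix_mult_def sum.distrib distrib_right scaleR_sum_right)

lemma linear_matrix_mult_right: "linear (\<lambda>N::complex^'p^'n. M ** N)"
  by (rule linearI)
     (simp_all add: vec_eq_iff matrix_matrix_mult_def sum.distrib distrib_left scaleR_sum_right)

lemma linear_matrix_transpose: "linear (transpose :: complex^'n^'m \<Rightarrow> complex^'m^'n)"
  by (rule linearI) (simp_all add: vec_eq_iff transpose_def)

text \<open>Conjugation is real-linear but not complex-linear. That suffices because the
  coefficients \<open>1 / fact k\<close> of the exponential series are real.\<close>

lemma linear_matrix_cnj: "linear (map_matrix cnj :: complex^'n^'m \<Rightarrow> complex^'n^'m)"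
  by (rule linearI) (simp_all add: vec_eq_iff map_matrix_def)

text \<open>Transposition reverses products, so the induction for
  \<open>transpose_matrix_power\<close> leaves the new factor on the right; this moves it back to
  the left.\<close>

lemma matrix_power_commute: "M ** matrix_power M k = matrix_power M k ** M"
proof (induction k)
  case (Suc k)
  then show ?case
    by (metis matrix_mul_assoc matrix_power.simps(2))
qed simp

lemma matrix_power_add: "matrix_power M (k + l) = matrix_power M k ** matrix_power M l"
  by (induction k) (simp_all add: matrix_mul_assoc [symmetric])

lemma matrix_power_scaleR:
  fixes M :: "complex^'n^'n"
  shows "matrix_power (x *\<^sub>R M) k = x ^ k *\<^sub>R matrix_power M k"
  by (induction k)
     (simp_all add: linear_scale [OF linear_matrix_mult_left] linear_scale [OF linear_matrix_mult_right])

lemma matrix_power_intertwine: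
  assumes "M ** S = S ** N"
  shows "matrix_power M k ** S = S ** matrix_power N k"
proof (induction k)
  case (Suc k)
  then show ?case
    by (metis assms matrix_mul_assoc matrix_power.simps(2))
qed simp

lemma transpose_matrix_power:
  fixes M :: "complex^'n^'n"
  shows "transpose (matrix_power M k) = matrix_power (transpose M) k"
  by (induction k) (simp_all add: matrix_transpose_mul matrix_power_commute)

lemma map_matrix_cnj_matrix_power:
  "map_matrix cnj (matrix_power M k) = matrix_power (map_matrix cnj M) k"
proof (induction k)
  case 0
  show ?case by (simp add: vec_eq_iff map_matrix_def mat_def)
next
  case (Suc k)
  then show ?case
    by (simp add: vec_eq_iff map_matrix_def matrix_matrix_mult_def cnj_sum)
qed

section \<open>The matrix exponential and its algebra\<close>

lemma sums_linear_matrix_exp: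
  fixes M :: "complex^'n^'n" and L :: "complex^'n^'n \<Rightarrow> 'b::real_normed_vector"
  assumes "linear L"
  shows "(\<lambda>k. (1 / fact k) *\<^sub>R L (matrix_power M k)) sums L (matrix_exp M)"
proof -
  \<comment> \<open>The domain is finite-dimensional, so a linear map on it is continuous and may be
    applied to the series term by term.\<close>
  have "bounded_linear L"
    using assms by (simp add: linear_conv_bounded_linear)
  from bounded_linear.sums [OF this summable_sums [OF summable_matrix_exp]]
  show ?thesis
    by (simp add: matrix_exp_def linear_scale [OF assms])
qed

text \<open>Both sides are sums of one and the same series, since each power satisfies the
  intertwining relation. \<open>S\<close> may be rectangular.\<close>

lemma matrix_exp_intertwine:
  fixes M :: "complex^'n^'n" and N :: "complex^'m^'m"
  assumes "M ** S = S ** N"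
  shows "matrix_exp M ** S = S ** matrix_exp N"
  using sums_linear_matrix_exp [OF linear_matrix_mult_left, of M S]
    sums_linear_matrix_exp [OF linear_matrix_mult_right, of S N]
  by (simp add: matrix_power_intertwine [OF assms] sums_unique2)

lemma transpose_matrix_exp: "transpose (matrix_exp M) = matrix_exp (transpose M)"
  using sums_unique [OF sums_linear_matrix_exp [OF linear_matrix_transpose, of M]]
  by (simp add: transpose_matrix_power matrix_exp_def)

lemma map_matrix_cnj_matrix_exp: "map_matrix cnj (matrix_exp M) = matrix_exp (map_matrix cnj M)"
  using sums_unique [OF sums_linear_matrix_exp [OF linear_matrix_cnj, of M]]
  by (simp add: map_matrix_cnj_matrix_power matrix_exp_def)

lemma matrix_exp_nth_sums:
  fixes M :: "complex^'n^'n"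
  shows "(\<lambda>k. ((1 / fact k) *\<^sub>R matrix_power M k) $ a $ b) sums (matrix_exp M $ a $ b)"
proof -
  have "linear (\<lambda>N::complex^'n^'n. N $ a $ b)"
    by (rule linearI) simp_all
  from sums_linear_matrix_exp [OF this, of M] show ?thesis by simp
qed

text \<open>Absolute convergence is what the Cauchy product in \<open>matrix_exp_add_scaleR\<close>
  requires. The entries are dominated by the exponential series of a real number.\<close>

lemma summable_norm_matrix_exp_nth:
  fixes M :: "complex^'n^'n"
  shows "summable (\<lambda>k. norm (((1 / fact k) *\<^sub>R matrix_power M k) $ a $ b))"
proof (rule summable_comparison_test')
  show "summable (\<lambda>k. inverse (fact k) * (real CARD('n) * norm M) ^ k)"
    by (rule summable_exp)
  have "norm (M $ i $ j) \<le> norm M" for i j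
    by (rule order_trans [OF Finite_Cartesian_Product.norm_nth_le Finite_Cartesian_Product.norm_nth_le])
  from matrix_power_entry_bound [OF this]
  show "norm (norm (((1 / fact k) *\<^sub>R matrix_power M k) $ a $ b))
      \<le> inverse (fact k) * (real CARD('n) * norm M) ^ k" if "k \<ge> 0" for k
    by (simp add: divide_inverse mult_left_mono)
qed

text \<open>Multiples of a single matrix commute, so the scalar proof works: Cauchy product plus
  binomial theorem. The Cauchy product is taken entry by entry, on complex series.\<close>

lemma matrix_exp_add_scaleR:
  fixes M :: "complex^'n^'n"
  shows "matrix_exp (x *\<^sub>R M) ** matrix_exp (y *\<^sub>R M) = matrix_exp ((x + y) *\<^sub>R M)"
proof -
  define T where "T = (\<lambda>z k. (1 / fact k) *\<^sub>R matrix_power (z *\<^sub>R M) k)"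
  have conv: "(\<Sum>k\<le>n. T x k ** T y (n - k)) = T (x + y) n" for n
  proof -
    \<comment> \<open>Writing 1/(k! (n-k)!) as a binomial coefficient over n! turns the sum over k
      into the expansion of (x + y)^n.\<close>
    have "T x k ** T y (n - k)
        = ((1 / fact n) * (of_nat (n choose k) * x ^ k * y ^ (n - k))) *\<^sub>R matrix_power M n"
      if "k \<le> n" for k
      using that
      by (simp add: T_def matrix_power_scaleR linear_scale [OF linear_matrix_mult_left]
          linear_scale [OF linear_matrix_mult_right] binomial_fact
          flip: matrix_power_add) (simp add: mult.commute)
    then have "(\<Sum>k\<le>n. T x k ** T y (n - k))
        = ((1 / fact n) * (x + y) ^ n) *\<^sub>R matrix_power M n"
      by (simp add: binomial_ring sum_distrib_left flip: scaleR_sum_left)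
    then show ?thesis
      by (simp add: T_def matrix_power_scaleR)
  qed
  have "(matrix_exp (x *\<^sub>R M) ** matrix_exp (y *\<^sub>R M)) $ a $ b
      = matrix_exp ((x + y) *\<^sub>R M) $ a $ b" for a b
  proof (rule sums_unique2)
    have "(\<lambda>n. \<Sum>k\<le>n. T x k $ a $ l * T y (n - k) $ l $ b) sums
        (matrix_exp (x *\<^sub>R M) $ a $ l * matrix_exp (y *\<^sub>R M) $ l $ b)" for l
      using Cauchy_product_sums [OF summable_norm_matrix_exp_nth summable_norm_matrix_exp_nth,
          of "x *\<^sub>R M" a l "y *\<^sub>R M" l b]
      by (simp only: sums_unique [OF matrix_exp_nth_sums, symmetric] T_def)
    then have "(\<lambda>n. \<Sum>l\<in>UNIV. \<Sum>k\<le>n. T x k $ a $ l * T y (n - k) $ l $ b) sums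
        (\<Sum>l\<in>UNIV. matrix_exp (x *\<^sub>R M) $ a $ l * matrix_exp (y *\<^sub>R M) $ l $ b)"
      by (rule sums_sum)
    \<comment> \<open>Exchanging the two sums makes the inner sum over \<open>l\<close> an entry of
      a matrix product, so that \<open>conv\<close> applies.\<close>
    moreover have "(\<Sum>l\<in>UNIV. \<Sum>k\<le>n. T x k $ a $ l * T y (n - k) $ l $ b) = T (x + y) n $ a $ b"
      for n
      by (simp add: conv [symmetric] matrix_matrix_mult_def sum.swap [of _ UNIV])
    ultimately show "(\<lambda>n. T (x + y) n $ a $ b) sums
        (matrix_exp (x *\<^sub>R M) ** matrix_exp (y *\<^sub>R M)) $ a $ b"
      by (simp add: matrix_matrix_mult_def)
    show "(\<lambda>n. T (x + y) n $ a $ b) sums matrix_exp ((x + y) *\<^sub>R M) $ a $ b"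
      unfolding T_def by (rule matrix_exp_nth_sums)
  qed
  then show ?thesis by (simp add: vec_eq_iff)
qed

lemma matrix_exp_zero: "matrix_exp 0 = mat 1"
proof -
  have *: "(1 / fact k) *\<^sub>R matrix_power (0 :: complex^'n^'n) k = 0" if "k \<notin> {0}" for k
    using that by (cases k) simp_all
  have "matrix_exp (0 :: complex^'n^'n)
      = (\<Sum>k\<in>{0}. (1 / fact k) *\<^sub>R matrix_power (0 :: complex^'n^'n) k)"
    unfolding matrix_exp_def by (rule suminf_finite) (use * in auto)
  then show ?thesis by simp
qed

lemma matrix_exp_uminus: "matrix_exp (- M) ** matrix_exp M = mat 1"
  using matrix_exp_add_scaleR [of "-1" M 1] by (simp add: matrix_exp_zero)

section \<open>Unitarity of the walk of a real symmetric matrix\<close>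

lemma quantum_walk_symmetric_unitary:
  fixes B :: "real^'m^'m" and t :: real
  assumes "transpose B = B"
  defines "U \<equiv> quantum_walk (map_matrix complex_of_real B) t"
  shows "transpose (map_matrix cnj U) ** U = mat 1"
proof -
  define M where "M = map_matrix (\<lambda>x. \<i> * complex_of_real t * x) (map_matrix complex_of_real B)"
  have "B $ a $ b = B $ b $ a" for a b
    using assms(1) by (metis transpose_def vec_lambda_beta)
  \<comment> \<open>\<open>M\<close> is itB. Conjugation only changes the sign of i, and
    transposition fixes B, so \<open>M\<close> is skew-Hermitian. Hence the adjoint of exp(M) is
    exp(-M), its inverse.\<close>
  then have "transpose (map_matrix cnj M) = - M"
    by (simp add: M_def vec_eq_iff transpose_def map_matrix_def)
  then show ?thesis
    by (simp add: U_def quantum_walk_def map_matrix_cnj_matrix_exp transpose_matrix_exp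
        matrix_exp_uminus flip: M_def)
qed

lemma matrix_vector_mult_axis: "M *v axis k (1 :: 'a::semiring_1) = column k M"
  by (simp add: vec_eq_iff matrix_vector_mult_def column_def axis_def if_distrib cong: if_cong)

text \<open>The diagonal entry of U*U at \<open>i\<close> is the squared norm of column
  \<open>i\<close> of U, whose only possibly nonzero entry is \<open>lam\<close>; unitarity makes it
  1.\<close>

lemma quantum_walk_symmetric_phase:
  fixes B :: "real^'m^'m"
  assumes "transpose B = B"
    and "quantum_walk (map_matrix complex_of_real B) t *v axis i 1 = lam *s axis j 1"
  shows "norm lam = 1"
proof -
  define U where "U = quantum_walk (map_matrix complex_of_real B) t"
  have col: "U $ l $ i = (if l = j then lam else 0)" for l
  proof -
    have "column i U = lam *s axis j 1"
      using assms(2) by (simp add: U_def flip: matrix_vector_mult_axis)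
    then show ?thesis
      by (auto simp: vec_eq_iff column_def axis_def)
  qed
  have "1 = (transpose (map_matrix cnj U) ** U) $ i $ i"
    using quantum_walk_symmetric_unitary [OF assms(1)] by (simp add: U_def mat_def)
  also have "\<dots> = (\<Sum>l\<in>UNIV. cnj (U $ l $ i) * U $ l $ i)"
    by (simp add: matrix_matrix_mult_def transpose_def map_matrix_def)
  also have "\<dots> = cnj lam * lam"
    by (simp add: col if_distrib [of cnj] if_distrib [of "\<lambda>z. z * _"] cong: if_cong)
  finally have "complex_of_real ((norm lam)\<^sup>2) = 1"
    by (simp add: complex_norm_square mult.commute del: of_real_power)
  then have "(norm lam)\<^sup>2 = 1"
    using of_real_eq_1_iff by blast
  \<comment> \<open>The square also allows the value -1, which a norm cannot take.\<close>
  then show ?thesis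
    by (simp add: power2_eq_1_iff) (use norm_ge_zero [of lam] in linarith)
qed

section \<open>Transfer along \<open>S\<close>\<close>

lemma quantum_walk_intertwine:
  assumes "A ** S = S ** N"
  shows "quantum_walk A t ** S = S ** quantum_walk N t"
  unfolding quantum_walk_def
proof (rule matrix_exp_intertwine)
  let ?c = "\<lambda>x. \<i> * complex_of_real t * x"
  have "map_matrix ?c A ** S = map_matrix ?c (A ** S)"
    by (simp add: vec_eq_iff map_matrix_def matrix_matrix_mult_def sum_distrib_left mult.assoc)
  also have "\<dots> = S ** map_matrix ?c N"
    unfolding assms
    by (simp add: vec_eq_iff map_matrix_def matrix_matrix_mult_def sum_distrib_left mult_ac)
  finally show "map_matrix ?c A ** S = S ** map_matrix ?c N" .
qed

lemma normalize_columns_axis: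
  assumes "M *v axis k 1 = axis w 1"
  shows "normalize_columns M *v axis k 1 = axis w 1"
proof -
  have "column k M = axis w 1"
    using assms by (simp add: matrix_vector_mult_axis)
  moreover from this have "norm (column k M) = 1"
    by (simp add: norm_vec_def L2_set_def axis_def if_distrib [of norm] if_distrib [of "\<lambda>x. x\<^sup>2"]
        cong: if_cong)
  ultimately show ?thesis
    by (simp add: matrix_vector_mult_axis normalize_columns_def vec_eq_iff column_def)
qed

lemma diagonal_mult_axis:
  fixes D :: "'a::semiring_1^'n^'n"
  assumes "\<And>x y. x \<noteq> y \<Longrightarrow> D $ x $ y = 0" and "D $ w $ w = 1"
  shows "D *v axis w 1 = axis w 1"
  unfolding matrix_vector_mult_axis using assms by (auto simp: vec_eq_iff column_def axis_def)

theorem theorem1: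
  fixes G :: "('v::finite, 'e) pre_digraph"
    and A :: "complex^'v^'v"
    and B :: "real^'m^'m"
    and C :: "'m::finite \<Rightarrow> 'v set"
    and P S :: "complex^'m^'v"
    and D :: "complex^'v^'v"
    and t :: real and lam :: complex
    and i j :: 'm and u v :: 'v
  assumes "graph G" and "verts G = UNIV"
    and "A = adjacency_matrix G"
    and "transpose B = B"
    and "quantum_walk (map_matrix complex_of_real B) t *v axis i 1 = lam *s axis j 1"
    and "partition_on (verts G) (range C)" and "inj C"
    and "P = characteristic_matrix C"
    and "\<And>x y. x \<noteq> y \<Longrightarrow> D $ x $ y = 0"
    and "P *v axis i 1 = axis u 1" and "P *v axis j 1 = axis v 1"
    and "D $ u $ u = 1" and "D $ v $ v = 1"
    and "\<And>w. w \<in> column_space (D ** P) \<Longrightarrow> A *v w \<in> column_space (D ** P)"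
    and "S = normalize_columns (D ** P)"
    and "A ** S = S ** map_matrix complex_of_real B"
  shows "perfect_state_transfer G u v"
proof -
  \<comment> \<open>Kept general in \<open>k\<close> and \<open>w\<close> to serve both the pair
    \<open>i\<close>, \<open>u\<close> and the pair \<open>j\<close>, \<open>v\<close>.\<close>
  have S: "S *v axis k 1 = axis w 1" if "P *v axis k 1 = axis w 1" "D $ w $ w = 1" for k w
    unfolding \<open>S = normalize_columns (D ** P)\<close>
    using that assms(9)
    by (intro normalize_columns_axis)
       (simp add: diagonal_mult_axis flip: matrix_vector_mul_assoc)
  have "quantum_walk A t *v axis u 1 = quantum_walk A t *v (S *v axis i 1)"
    using S assms by simp
  also have "\<dots> = S *v (quantum_walk (map_matrix complex_of_real B) t *v axis i 1)"
    by (simp add: matrix_vector_mul_assoc quantum_walk_intertwine [OF assms(16)])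
  also have "\<dots> = lam *s (S *v axis j 1)"
    by (simp add: assms(5) matrix_vector_mult_scaleR vector_scalar_commute)
  also have "\<dots> = lam *s axis v 1"
    using S assms by simp
  finally show ?thesis
    unfolding perfect_state_transfer_def \<open>A = adjacency_matrix G\<close>
    using quantum_walk_symmetric_phase [OF assms(4,5)] by blast
qed

end
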